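(* Let $f$ and $F$ be primitive integral binary quadratic forms with non-square discriminants $d$ and $D$, respectively, and suppose $f(\mathbb{Z}^2)=F(\mathbb{Z}^2)$. Then $d$ and $D$ have the same sign, and $d=D$, $d=4D$, or $4d=D$. Furthermore, if $0<|d|<|D|$, then $d\equiv 5\pmod 8$.
   Context: A form $aX^2+bXY+cY^2$ with $a,b,c\in\mathbb{Z}$ is primitive if $\gcd(a,b,c)=1$; its discriminant is $b^2-4ac$. *)

theory Defs
  imports "HOL-Number_Theory.Number_Theory" "HOL-Computational_Algebra.Nth_Powers"
begin

text \<open>\<open>BQF a b c\<close> is the integral binary quadratic form \<open>a X\<^sup>2 + b X Y + c Y\<^sup>2\<close>;
  the middle coefficient \<open>b\<close> is not required to be even.\<close>

datatype bqf = BQF (coeff_XX: int) (coeff_XY: int) (coeff_YY: int)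

definition bqf_eval :: "bqf \<Rightarrow> int \<times> int \<Rightarrow> int" where
  "bqf_eval f = (\<lambda>(x, y). coeff_XX f * x\<^sup>2 + coeff_XY f * x * y + coeff_YY f * y\<^sup>2)"

definition bqf_primitive :: "bqf \<Rightarrow> bool" where
  "bqf_primitive f \<longleftrightarrow> Gcd {coeff_XX f, coeff_XY f, coeff_YY f} = 1"

definition bqf_disc :: "bqf \<Rightarrow> int" where
  "bqf_disc f = (coeff_XY f)\<^sup>2 - 4 * coeff_XX f * coeff_YY f"

end

theory Submission
  imports Defs
begin

text \<open>Let \<open>q\<close> be the principal form of discriminant \<open>d\<close>. If \<open>f\<close> takes the value \<open>s\<close>, then \<open>s f\<close> takes
  only values of \<open>q\<close>, and \<open>s q\<close> takes only values of \<open>f\<close>. Hence, if \<open>f\<close> and \<open>F\<close> have the same values,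
  \<open>s\<^sup>2 q\<close> takes only values of the principal form \<open>Q\<close> of discriminant \<open>D\<close>, and vice versa; by
  primitivity \<open>s\<close> can be chosen prime to any given prime \<open>p\<close>. Completing squares, this compares the
  values of \<open>X\<^sup>2 - d Y\<^sup>2\<close> and \<open>X\<^sup>2 - D Y\<^sup>2\<close> modulo powers of \<open>p\<close>, which determines the \<open>p\<close>-part of the
  discriminant for odd \<open>p\<close>, and, by congruences modulo 4 and 8, up to the stated exception
  for \<open>p = 2\<close>.\<close>

section \<open>The principal form of a discriminant\<close>

text \<open>For \<open>d\<close> congruent to 0 or 1 modulo 4 the division is exact, and this is the
  norm form of the quadratic order of discriminant \<open>d\<close> in the basis 1,
  \<open>(e + sqrt d) / 2\<close>, where \<open>e = d mod 2\<close>.\<close>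

definition principal_form :: "int \<Rightarrow> int \<Rightarrow> int \<Rightarrow> int" where
  "principal_form d x y = x\<^sup>2 + (d mod 2) * x * y + ((d mod 2 - d) div 4) * y\<^sup>2"

text \<open>The multiplier \<open>s\<close> is invertible modulo powers of \<open>p\<close>: modulo these, every value of the first
  principal form is, up to a unit square, a value of the second.\<close>

definition principal_transfer :: "int \<Rightarrow> int \<Rightarrow> int \<Rightarrow> bool" where
  "principal_transfer p d D \<longleftrightarrow>
    (\<exists>s. \<not> p dvd s \<and> (\<forall>X Y. \<exists>x y. s\<^sup>2 * principal_form d X Y = principal_form D x y))"

lemma bqf_disc_mod_4: "bqf_disc f mod 4 = 0 \<or> bqf_disc f mod 4 = 1"
proof -
  have "bqf_disc f mod 4 = (coeff_XY f)\<^sup>2 mod 4"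
    by (simp add: bqf_disc_def mod_eq_dvd_iff)
  moreover have "(coeff_XY f)\<^sup>2 mod 4 = (coeff_XY f mod 4)\<^sup>2 mod 4"
    by (simp add: power_mod)
  moreover have "coeff_XY f mod 4 \<in> {0,1,2,3}"
    using pos_mod_bound[of 4 "coeff_XY f"] pos_mod_sign[of 4 "coeff_XY f"] by auto
  ultimately show ?thesis by auto
qed

lemma four_principal_form:
  assumes "d mod 4 = 0 \<or> d mod 4 = 1"
  shows "4 * principal_form d x y = (2 * x + (d mod 2) * y)\<^sup>2 - d * y\<^sup>2"
proof -
  have m: "d mod 2 = d mod 4" using assms by presburger
  have "4 * ((d mod 2 - d) div 4) = d mod 2 - d" using assms by presburger
  then have e: "4 * ((d mod 2 - d) div 4) * y\<^sup>2 = (d mod 2 - d) * y\<^sup>2" by simp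
  have "(d mod 2)\<^sup>2 = d mod 2" using assms m by auto
  then have e2: "(d mod 2)\<^sup>2 * y\<^sup>2 = (d mod 2) * y\<^sup>2" by simp
  have "4 * principal_form d x y = 4 * x\<^sup>2 + 4 * (d mod 2) * x * y + 4 * ((d mod 2 - d) div 4) * y\<^sup>2"
    by (simp add: principal_form_def algebra_simps)
  also have "\<dots> = 4 * x\<^sup>2 + 4 * (d mod 2) * x * y + (d mod 2)\<^sup>2 * y\<^sup>2 - d * y\<^sup>2"
    unfolding e e2 by (simp add: algebra_simps)
  also have "\<dots> = (2 * x + (d mod 2) * y)\<^sup>2 - d * y\<^sup>2"
    by (simp only: power2_eq_square) (simp add: algebra_simps)
  finally show ?thesis .
qed

text \<open>Restricting to even second coordinates removes the mixed term, so every value of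
  \<open>X^2 - d Y^2\<close> is a value of the principal form.\<close>

lemma principal_form_diff_squares:
  assumes "d mod 4 = 0 \<or> d mod 4 = 1"
  shows "principal_form d (x - (d mod 2) * y) (2 * y) = x\<^sup>2 - d * y\<^sup>2"
proof -
  have "4 * principal_form d (x - (d mod 2) * y) (2 * y) = 4 * (x\<^sup>2 - d * y\<^sup>2)"
    unfolding four_principal_form[OF assms] by (simp add: algebra_simps power2_eq_square)
  then show ?thesis by simp
qed

lemma principal_form_mult_four: "principal_form (4 * d) x y = x\<^sup>2 - d * y\<^sup>2"
proof -
  have "(- (4 * d)) div 4 = - d" by presburger
  then show ?thesis by (simp add: principal_form_def)
qed

section \<open>Products of values of a form and of its principal form\<close>

text \<open>The identity behind this is \<open>4 f(v) f(w) = B^2 - d y^2\<close>, with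
  \<open>B\<close> the polar form of \<open>f\<close> at \<open>v\<close>, \<open>w\<close> and
  \<open>y\<close> the determinant of \<open>v\<close>, \<open>w\<close>. Since \<open>B\<close>,
  \<open>b y\<close> and \<open>d y\<close> agree modulo 2, the square can be un-completed over the
  integers.\<close>

lemma mult_bqf_values_principal:
  "\<exists>x y. bqf_eval f v * bqf_eval f w = principal_form (bqf_disc f) x y"
proof -
  obtain a b c where f: "f = BQF a b c" by (cases f)
  obtain v1 v2 where v: "v = (v1, v2)" by (cases v)
  obtain w1 w2 where w: "w = (w1, w2)" by (cases w)
  define y where "y = v1 * w2 - v2 * w1"
  define B where "B = 2 * a * v1 * w1 + b * (v1 * w2 + v2 * w1) + 2 * c * v2 * w2"
  define e where "e = bqf_disc f mod 2"
  have "even (b - e)" unfolding e_def f bqf_disc_def by (simp add: mod_2_eq_odd)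
  then have "even (B - e * y)" unfolding B_def y_def by auto
  then obtain x where "B - e * y = 2 * x" by blast
  then have "2 * x + e * y = B" by simp
  then have "4 * principal_form (bqf_disc f) x y = B\<^sup>2 - bqf_disc f * y\<^sup>2"
    unfolding four_principal_form[OF bqf_disc_mod_4] e_def by simp
  also have "\<dots> = 4 * (bqf_eval f v * bqf_eval f w)"
    unfolding f v w bqf_eval_def bqf_disc_def B_def y_def
    by (simp add: algebra_simps power2_eq_square)
  finally show ?thesis by (metis mult_cancel_left zero_neq_numeral)
qed

lemma mult_principal_bqf_value:
  "\<exists>w. bqf_eval f v * principal_form (bqf_disc f) X Y = bqf_eval f w"
proof -
  obtain a b c where f: "f = BQF a b c" by (cases f)
  obtain v1 v2 where v: "v = (v1, v2)" by (cases v)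
  define e where "e = bqf_disc f mod 2"
  have "even (b - e)" unfolding e_def f bqf_disc_def by (simp add: mod_2_eq_odd)
  then have "even (e * v1 - b * v1 - 2 * c * v2)" "even (e * v2 + 2 * a * v1 + b * v2)"
    by auto
  \<comment> \<open>\<open>(u1, u2)\<close> is the image of \<open>v\<close> under an integral
    matrix of trace \<open>e\<close> and determinant \<open>(e - d) / 4\<close>, where
    \<open>d\<close> is the discriminant: the action of \<open>(e + sqrt d) / 2\<close> on the
    lattice. This matrix scales \<open>f\<close> by its determinant.\<close>
  then obtain u1 u2 where u: "e * v1 - b * v1 - 2 * c * v2 = 2 * u1" "e * v2 + 2 * a * v1 + b * v2 = 2 * u2"
    by blast
  define w1 w2 where "w1 = X * v1 + Y * u1" and "w2 = X * v2 + Y * u2"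
  have w: "2 * w1 = 2 * X * v1 + Y * (e * v1 - b * v1 - 2 * c * v2)"
          "2 * w2 = 2 * X * v2 + Y * (e * v2 + 2 * a * v1 + b * v2)"
    unfolding u by (simp_all add: w1_def w2_def algebra_simps)
  have "4 * bqf_eval f (w1, w2) = a * (2 * w1)\<^sup>2 + b * (2 * w1) * (2 * w2) + c * (2 * w2)\<^sup>2"
    by (simp add: f bqf_eval_def power_mult_distrib)
  also have "\<dots> = bqf_eval f v * ((2 * X + e * Y)\<^sup>2 - bqf_disc f * Y\<^sup>2)"
    unfolding w f v bqf_eval_def bqf_disc_def by (simp add: algebra_simps power2_eq_square)
  also have "\<dots> = 4 * (bqf_eval f v * principal_form (bqf_disc f) X Y)"
    using four_principal_form[OF bqf_disc_mod_4] by (simp add: e_def)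
  finally show ?thesis by (metis mult_cancel_left zero_neq_numeral)
qed

text \<open>The values at (1, 0), (0, 1) and (1, 1) generate the same ideal as the
  coefficients.\<close>

lemma bqf_primitive_value_not_dvd:
  assumes "bqf_primitive f" "prime p"
  shows "\<exists>v. \<not> p dvd bqf_eval f v"
proof (rule ccontr)
  assume "\<nexists>v. \<not> p dvd bqf_eval f v"
  then have all: "p dvd bqf_eval f v" for v by blast
  have 1: "p dvd coeff_XX f" using all[of "(1, 0)"] by (simp add: bqf_eval_def)
  have 2: "p dvd coeff_YY f" using all[of "(0, 1)"] by (simp add: bqf_eval_def)
  have "p dvd coeff_XX f + coeff_XY f + coeff_YY f" using all[of "(1, 1)"] by (simp add: bqf_eval_def)
  then have "p dvd coeff_XY f" using 1 2 by (metis dvd_add_left_iff dvd_add_right_iff)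
  with 1 2 have "p dvd Gcd {coeff_XX f, coeff_XY f, coeff_YY f}" by (auto intro: Gcd_greatest)
  then have "is_unit p" using assms(1) unfolding bqf_primitive_def by metis
  then show False using assms(2) not_prime_unit by blast
qed

text \<open>The multiplier is a value \<open>s\<close> of \<open>f\<close> prime to
  \<open>p\<close>. Both \<open>s\<close> and \<open>s q(X, Y)\<close> are values of
  \<open>f\<close>, hence of \<open>F\<close>, so their product is a value of the principal form of
  \<open>F\<close>.\<close>

lemma principal_transfer_of_range_eq:
  assumes "bqf_primitive f" "prime p" "range (bqf_eval f) = range (bqf_eval F)"
  shows "principal_transfer p (bqf_disc f) (bqf_disc F)"
proof -
  obtain v where v: "\<not> p dvd bqf_eval f v" using bqf_primitive_value_not_dvd assms by blast
  obtain v' where v': "bqf_eval f v = bqf_eval F v'" using assms(3) by blast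
  have "\<exists>x y. (bqf_eval f v)\<^sup>2 * principal_form (bqf_disc f) X Y = principal_form (bqf_disc F) x y" for X Y
  proof -
    obtain w where w: "bqf_eval f v * principal_form (bqf_disc f) X Y = bqf_eval f w"
      using mult_principal_bqf_value by blast
    obtain w' where w': "bqf_eval f w = bqf_eval F w'" using assms(3) by blast
    have "(bqf_eval f v)\<^sup>2 * principal_form (bqf_disc f) X Y = bqf_eval F v' * bqf_eval F w'"
      using w w' v' by (simp add: power2_eq_square mult.assoc)
    then show ?thesis using mult_bqf_values_principal by metis
  qed
  with v show ?thesis unfolding principal_transfer_def by blast
qed

text \<open>For \<open>D < 0\<close> the target form is nonnegative, while the source form takes the
  value \<open>-d\<close>.\<close>

lemma principal_transfer_neg:
  assumes "principal_transfer p d D" "d mod 4 = 0 \<or> d mod 4 = 1" "D mod 4 = 0 \<or> D mod 4 = 1" "D < 0"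
  shows "d \<le> 0"
proof -
  obtain s where s: "\<not> p dvd s" "\<forall>X Y. \<exists>x y. s\<^sup>2 * principal_form d X Y = principal_form D x y"
    using assms(1) unfolding principal_transfer_def by blast
  obtain x y where xy: "s\<^sup>2 * (- d) = principal_form D x y"
    using s(2) principal_form_diff_squares[OF assms(2), of 0 1] by (metis (no_types) diff_0 mult.right_neutral one_power2 power_zero_numeral)
  have "D * y\<^sup>2 \<le> 0" using assms(4) by (simp add: mult_nonpos_nonneg)
  then have "0 \<le> (2 * x + (D mod 2) * y)\<^sup>2 - D * y\<^sup>2"
    by (smt (verit) zero_le_power2)
  then have "0 \<le> s\<^sup>2 * (- d)" using xy four_principal_form[OF assms(3), of x y] by linarith
  moreover have "s\<^sup>2 > 0" using s(1) by auto
  ultimately show ?thesis by (simp add: mult_le_0_iff)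
qed

section \<open>Diagonal forms and the multiplicity of a prime in the discriminant\<close>

text \<open>At the point \<open>(m X, Y)\<close> the left side is divisible by \<open>m^2\<close>,
  which forces \<open>m\<close> to divide \<open>x\<close>; then \<open>m^2\<close> cancels.\<close>

lemma square_form_transfer_cancel:
  fixes m :: int
  assumes "m \<noteq> 0"
    and H: "\<forall>X Y. \<exists>x y. c\<^sup>2 * (X\<^sup>2 - (m\<^sup>2 * d) * Y\<^sup>2) = x\<^sup>2 - (m\<^sup>2 * D) * y\<^sup>2"
  shows "\<forall>X Y. \<exists>x y. c\<^sup>2 * (X\<^sup>2 - d * Y\<^sup>2) = x\<^sup>2 - D * y\<^sup>2"
proof (intro allI)
  fix X Y
  obtain x y where "c\<^sup>2 * ((m * X)\<^sup>2 - (m\<^sup>2 * d) * Y\<^sup>2) = x\<^sup>2 - (m\<^sup>2 * D) * y\<^sup>2"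
    using H by blast
  then have eq: "x\<^sup>2 = m\<^sup>2 * (c\<^sup>2 * (X\<^sup>2 - d * Y\<^sup>2) + D * y\<^sup>2)"
    by (simp add: algebra_simps power_mult_distrib)
  then have "m\<^sup>2 dvd x\<^sup>2" by simp
  then have "m dvd x" by simp
  then obtain x' where "x = m * x'" by blast
  with eq have "x'\<^sup>2 = c\<^sup>2 * (X\<^sup>2 - d * Y\<^sup>2) + D * y\<^sup>2"
    using assms(1) by (simp add: power_mult_distrib)
  then show "\<exists>x y. c\<^sup>2 * (X\<^sup>2 - d * Y\<^sup>2) = x\<^sup>2 - D * y\<^sup>2" by (metis add_diff_cancel_right')
qed

text \<open>In a representation \<open>- c^2 d = x^2 - D y^2\<close> the term \<open>D y^2\<close>
  is divisible by a higher power of \<open>p\<close> than \<open>d\<close>, so \<open>x^2\<close>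
  and \<open>d\<close> have equal multiplicity, which is therefore even.\<close>

lemma square_form_transfer_even_multiplicity:
  fixes p c d D :: int
  assumes p: "prime p" and c: "\<not> p dvd c" and nz: "d \<noteq> 0" and lt: "multiplicity p d < multiplicity p D"
    and H: "\<forall>X Y. \<exists>x y. c\<^sup>2 * (X\<^sup>2 - d * Y\<^sup>2) = x\<^sup>2 - D * y\<^sup>2"
  obtains r e E where "d = (p ^ r)\<^sup>2 * e" "\<not> p dvd e" "D = (p ^ r)\<^sup>2 * (p * E)"
proof -
  define k where "k = multiplicity p d"
  have pu: "\<not> is_unit p" using p not_prime_unit by blast
  obtain e where e: "d = p ^ k * e" "\<not> p dvd e"
    using multiplicity_decompose'[OF nz pu] unfolding k_def by blast
  have "p ^ Suc k dvd D" by (rule multiplicity_dvd') (use lt k_def in simp)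
  then obtain E where E: "D = p ^ k * (p * E)" by (auto simp: dvd_def ac_simps)
  obtain x y where "c\<^sup>2 * (0\<^sup>2 - d * 1\<^sup>2) = x\<^sup>2 - D * y\<^sup>2" using H by blast
  then have x: "x\<^sup>2 = p ^ k * (p * (E * y\<^sup>2) - c\<^sup>2 * e)"
    by (simp add: e(1) E algebra_simps)
  have "\<not> p dvd c\<^sup>2 * e" using p c e(2) by (simp add: prime_dvd_mult_iff prime_dvd_power_iff)
  then have nd: "\<not> p dvd p * (E * y\<^sup>2) - c\<^sup>2 * e" by (simp add: dvd_diff_right_iff)
  then have "multiplicity p (x\<^sup>2) = k" using x p by (intro multiplicity_decomposeI) auto
  moreover have "x \<noteq> 0" using x nd p by auto
  ultimately have "k = 2 * multiplicity p x"
    using prime_elem_multiplicity_power_distrib[of p x 2] prime_imp_prime_elem[OF p] by simp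
  then have "p ^ k = (p ^ multiplicity p x)\<^sup>2" by (simp add: power_mult mult.commute)
  then show ?thesis using that[of "multiplicity p x" e E] e E by simp
qed

text \<open>Otherwise squaring would be surjective, hence injective, on the residues, but 1 and
  \<open>p - 1\<close> have the same square.\<close>

lemma not_all_squares_mod_odd_prime:
  fixes p :: int
  assumes "prime p" "p \<noteq> 2"
  shows "\<exists>n::nat. \<nexists>x. [int n = x\<^sup>2] (mod p)"
proof (rule ccontr)
  assume "\<nexists>n::nat. \<nexists>x. [int n = x\<^sup>2] (mod p)"
  then have all: "\<exists>x. [int n = x\<^sup>2] (mod p)" for n by blast
  have p3: "p > 2" using assms prime_ge_2_int[of p] by simp
  define g where "g x = x\<^sup>2 mod p" for x
  have "{0..<p} \<subseteq> g ` {0..<p}"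
  proof
    fix z assume z: "z \<in> {0..<p}"
    obtain x where "[z = x\<^sup>2] (mod p)" using all[of "nat z"] z by auto
    then have "z = g (x mod p)" using z by (simp add: g_def cong_def power_mod)
    then show "z \<in> g ` {0..<p}" using p3 by auto
  qed
  then have "inj_on g {0..<p}" by (intro finite_surj_inj) simp_all
  moreover have "g 1 = g (p - 1)"
  proof -
    have "(p - 1)\<^sup>2 - 1\<^sup>2 = p * (p - 2)" by (simp add: power2_eq_square algebra_simps)
    then show ?thesis unfolding g_def mod_eq_dvd_iff by (metis dvd_triv_left dvd_minus_iff minus_diff_eq)
  qed
  ultimately show False using p3 by (auto dest!: inj_onD)
qed

text \<open>If \<open>d\<close> had the smaller multiplicity, the squares modulo \<open>p\<close> would be closed under addition.\<close>

lemma square_form_transfer_odd_multiplicity: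
  fixes p c d D :: int
  assumes p: "prime p" "p \<noteq> 2" and c: "\<not> p dvd c" and nz: "d \<noteq> 0"
    and H: "\<forall>X Y. \<exists>x y. c\<^sup>2 * (X\<^sup>2 - d * Y\<^sup>2) = x\<^sup>2 - D * y\<^sup>2"
  shows "multiplicity p D \<le> multiplicity p d"
proof (rule ccontr)
  assume "\<not> ?thesis"
  then have "multiplicity p d < multiplicity p D" by simp
  from square_form_transfer_even_multiplicity[OF p(1) c nz this H]
  obtain r e E where r: "d = (p ^ r)\<^sup>2 * e" "\<not> p dvd e" "D = (p ^ r)\<^sup>2 * (p * E)" .
  have "p ^ r \<noteq> 0" using p by auto
  note cancelled = square_form_transfer_cancel[OF this H[unfolded r]]
  \<comment> \<open>Modulo \<open>p\<close> the term with \<open>D\<close> drops out, leaving only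
    squares on the right.\<close>
  have sq: "\<exists>x. [c\<^sup>2 * (X\<^sup>2 - e * Y\<^sup>2) = x\<^sup>2] (mod p)" for X Y
  proof -
    obtain x y where "c\<^sup>2 * (X\<^sup>2 - e * Y\<^sup>2) = x\<^sup>2 - p * E * y\<^sup>2" using cancelled by blast
    then have "c\<^sup>2 * (X\<^sup>2 - e * Y\<^sup>2) - x\<^sup>2 = p * (- (E * y\<^sup>2))" by simp
    then show ?thesis unfolding cong_iff_dvd_diff by (metis dvd_triv_left)
  qed
  \<comment> \<open>At (0, 1) this makes \<open>- e c^2\<close> a square modulo \<open>p\<close>,
    nonzero since \<open>p\<close> divides neither \<open>c\<close> nor \<open>e\<close>.\<close>
  obtain w where w: "[c\<^sup>2 * (0\<^sup>2 - e * 1\<^sup>2) = w\<^sup>2] (mod p)" using sq by blast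
  have ndw: "\<not> p dvd w"
  proof
    assume "p dvd w"
    then have "[w\<^sup>2 = 0] (mod p)" by (simp add: cong_0_iff power2_eq_square)
    with w have "[c\<^sup>2 * (0\<^sup>2 - e * 1\<^sup>2) = 0] (mod p)" using cong_trans by blast
    then show False using p c r(2) by (simp add: cong_0_iff prime_dvd_mult_iff prime_dvd_power_iff)
  qed
  then have "\<not> p dvd c * w" using p c by (simp add: prime_dvd_mult_iff)
  then have "coprime (c * w) p" using p by (metis coprime_commute prime_imp_coprime)
  then obtain g where g: "[c * w * g = 1] (mod p)" using cong_solve_coprime_int by blast
  have sum: "\<exists>x. [u\<^sup>2 + v\<^sup>2 = x\<^sup>2] (mod p)" for u v
  proof -
    \<comment> \<open>With \<open>g\<close> inverse to \<open>c w\<close>, these arguments turn the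
      two terms into \<open>u^2\<close> and \<open>v^2\<close> modulo \<open>p\<close>.\<close>
    obtain x where x: "[c\<^sup>2 * ((w * g * u)\<^sup>2 - e * (c * g * v)\<^sup>2) = x\<^sup>2] (mod p)" using sq by blast
    have "c\<^sup>2 * ((w * g * u)\<^sup>2 - e * (c * g * v)\<^sup>2)
        = (c * w * g)\<^sup>2 * u\<^sup>2 + c\<^sup>2 * (0\<^sup>2 - e * 1\<^sup>2) * (c * g * v)\<^sup>2"
      by (simp add: algebra_simps power_mult_distrib)
    also have "[\<dots> = (c * w * g)\<^sup>2 * u\<^sup>2 + w\<^sup>2 * (c * g * v)\<^sup>2] (mod p)"
      by (intro cong_add cong_mult w cong_refl)
    also have "(c * w * g)\<^sup>2 * u\<^sup>2 + w\<^sup>2 * (c * g * v)\<^sup>2 = (c * w * g)\<^sup>2 * (u\<^sup>2 + v\<^sup>2)"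
      by (simp add: algebra_simps power_mult_distrib)
    also have "[\<dots> = 1\<^sup>2 * (u\<^sup>2 + v\<^sup>2)] (mod p)"
      by (intro cong_mult cong_pow g cong_refl)
    finally have "[u\<^sup>2 + v\<^sup>2 = c\<^sup>2 * ((w * g * u)\<^sup>2 - e * (c * g * v)\<^sup>2)] (mod p)"
      by (simp add: cong_sym_eq)
    with x show ?thesis using cong_trans by blast
  qed
  \<comment> \<open>Starting from 0, repeated addition of the square 1 reaches every
    residue.\<close>
  have "\<exists>x. [int n = x\<^sup>2] (mod p)" for n
  proof (induction n)
    case 0
    show ?case by (rule exI[of _ 0]) simp
  next
    case (Suc n)
    then obtain x where "[int n = x\<^sup>2] (mod p)" by blast
    then have "[int (Suc n) = x\<^sup>2 + 1\<^sup>2] (mod p)" by (simp add: cong_add_rcancel add.commute[of 1])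
    with sum[of x 1] show ?case using cong_trans by blast
  qed
  with not_all_squares_mod_odd_prime[OF p] show False by blast
qed

section \<open>Congruences modulo 4 and 8, and the prime 2\<close>

lemma square_form_mod:
  fixes x y e n :: int
  shows "(x\<^sup>2 - e * y\<^sup>2) mod n = ((x mod n)\<^sup>2 - (e mod n) * (y mod n)\<^sup>2) mod n"
  by (intro cong_diff[unfolded cong_def] cong_mult[unfolded cong_def] cong_pow[unfolded cong_def]) simp_all

lemma mod_4_cases: "(x::int) mod 4 \<in> {0, 1, 2, 3}"
  using pos_mod_bound[of 4 x] pos_mod_sign[of 4 x] by auto

lemma mod_8_cases: "(x::int) mod 8 \<in> {0, 1, 2, 3, 4, 5, 6, 7}"
  using pos_mod_bound[of 8 x] pos_mod_sign[of 8 x] by auto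

lemma odd_square_mod_8: "odd (s::int) \<Longrightarrow> s\<^sup>2 mod 8 = 1"
proof -
  assume "odd s"
  moreover have "s mod 2 = (s mod 8) mod 2" by (simp add: mod_mod_cancel)
  ultimately show ?thesis using mod_8_cases[of s] by (auto simp: power_mod[of s 8 2, symmetric] odd_iff_mod_2_eq_one)
qed

lemma odd_square_mult_mod_8: "odd (s::int) \<Longrightarrow> (s\<^sup>2 * z) mod 8 = z mod 8"
  by (metis odd_square_mod_8 mod_mult_left_eq mult_1)

lemma odd_square_mult_mod_4: "odd (s::int) \<Longrightarrow> (s\<^sup>2 * z) mod 4 = z mod 4"
proof -
  assume "odd s"
  then have "(s\<^sup>2 * z) mod 8 mod 4 = z mod 8 mod 4" by (simp add: odd_square_mult_mod_8)
  then show ?thesis by (simp add: mod_mod_cancel)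
qed

text \<open>Modulo 4 this is a difference of two squares, each 0 or 1.\<close>

lemma square_form_mod_4_neq_2:
  fixes x y e :: int
  assumes "e mod 4 = 1"
  shows "(x\<^sup>2 - e * y\<^sup>2) mod 4 \<noteq> 2"
  unfolding square_form_mod[of x e y 4] assms using mod_4_cases[of x] mod_4_cases[of y]
  by (elim insertE emptyE; simp only:; simp)

text \<open>Modulo 4 this is a sum of two squares, each 0 or 1.\<close>

lemma square_form_mod_4_neq_3:
  fixes x y e :: int
  assumes "e mod 4 = 3"
  shows "(x\<^sup>2 - e * y\<^sup>2) mod 4 \<noteq> 3"
  unfolding square_form_mod[of x e y 4] assms using mod_4_cases[of x] mod_4_cases[of y]
  by (elim insertE emptyE; simp only:; simp)

text \<open>After cancelling a power of 4, an odd \<open>e\<close> faces an even \<open>2 E\<close>.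
  Odd multipliers have squares congruent to 1, so both forms take the same residues modulo 4; this
  is contradictory for either parity of \<open>E\<close>.\<close>

lemma square_form_transfer_multiplicity_two:
  fixes c c' d D :: int
  assumes c: "odd c" "odd c'" and nz: "d \<noteq> 0"
    and H: "\<forall>X Y. \<exists>x y. c\<^sup>2 * (X\<^sup>2 - d * Y\<^sup>2) = x\<^sup>2 - D * y\<^sup>2"
    and H': "\<forall>X Y. \<exists>x y. c'\<^sup>2 * (X\<^sup>2 - D * Y\<^sup>2) = x\<^sup>2 - d * y\<^sup>2"
  shows "multiplicity 2 D \<le> multiplicity 2 d"
proof (rule ccontr)
  assume "\<not> ?thesis"
  then have lt: "multiplicity 2 d < multiplicity 2 D" by simp
  have "prime (2::int)" by simp
  from square_form_transfer_even_multiplicity[OF this c(1) nz lt H]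
  obtain r e E where r: "d = (2 ^ r)\<^sup>2 * e" "odd e" "D = (2 ^ r)\<^sup>2 * (2 * E)" .
  have nz2: "(2::int) ^ r \<noteq> 0" by simp
  have A: "\<exists>x y. (X\<^sup>2 - e * Y\<^sup>2) mod 4 = (x\<^sup>2 - 2 * E * y\<^sup>2) mod 4" for X Y
    using square_form_transfer_cancel[OF nz2 H[unfolded r]] odd_square_mult_mod_4[OF c(1)] by metis
  have B: "\<exists>x y. (X\<^sup>2 - 2 * E * Y\<^sup>2) mod 4 = (x\<^sup>2 - e * y\<^sup>2) mod 4" for X Y
    using square_form_transfer_cancel[OF nz2 H'[unfolded r]] odd_square_mult_mod_4[OF c(2)] by metis
  have e: "e mod 4 = 1 \<or> e mod 4 = 3" using r(2) by presburger
  show False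
  proof (cases "even E")
    case True
    then have E0: "(2 * E) mod 4 = 0" by presburger
    \<comment> \<open>The form with \<open>2 E\<close> takes only squares modulo 4, whereas one of
      \<open>- e\<close> and \<open>1 - e\<close> is 3 or 2.\<close>
    have sq: "(x\<^sup>2 - 2 * E * y\<^sup>2) mod 4 \<in> {0, 1}" for x y
      unfolding square_form_mod[of x "2 * E" y 4] E0 using mod_4_cases[of x] by auto
    have "(0\<^sup>2 - e * 1\<^sup>2) mod 4 \<in> {0, 1}" "(1\<^sup>2 - e * 1\<^sup>2) mod 4 \<in> {0, 1}"
      using A sq by metis+
    then have "(- e) mod 4 \<in> {0, 1}" "(1 - e) mod 4 \<in> {0, 1}" by simp_all
    moreover have "(- e) mod 4 = 3 \<or> (1 - e) mod 4 = 2" using e by presburger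
    ultimately show False by auto
  next
    case False
    then have E2: "(2 * E) mod 4 = 2" by presburger
    \<comment> \<open>The form with \<open>2 E\<close> now takes both residues 2 and 3, one of which
      the form with \<open>e\<close> omits.\<close>
    obtain x y where 1: "(0\<^sup>2 - 2 * E * 1\<^sup>2) mod 4 = (x\<^sup>2 - e * y\<^sup>2) mod 4" using B by blast
    obtain x' y' where 2: "(1\<^sup>2 - 2 * E * 1\<^sup>2) mod 4 = (x'\<^sup>2 - e * y'\<^sup>2) mod 4" using B by blast
    have "(x\<^sup>2 - e * y\<^sup>2) mod 4 = 2" unfolding 1[symmetric] using E2 by (simp; presburger)
    moreover have "(x'\<^sup>2 - e * y'\<^sup>2) mod 4 = 3" unfolding 2[symmetric] using E2 by (simp; presburger)
    ultimately show False using e square_form_mod_4_neq_2 square_form_mod_4_neq_3 by blast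
  qed
qed

text \<open>The form of odd discriminant takes too many residues: modulo 8 for an even
  \<open>D\<close>, and modulo 4 for an odd \<open>D\<close> if \<open>d\<close> is 1 modulo
  8.\<close>

lemma principal_transfer_odd_disc:
  fixes d D :: int
  assumes "d mod 4 = 1" "principal_transfer 2 d (4 * D)"
  shows "odd D \<and> d mod 8 = 5"
proof -
  obtain s where s: "odd s" "\<forall>X Y. \<exists>x y. s\<^sup>2 * principal_form d X Y = x\<^sup>2 - D * y\<^sup>2"
    using assms(2) unfolding principal_transfer_def principal_form_mult_four by blast
  have d2: "d mod 2 = 1" using assms(1) by presburger
  define g where "g = (1 - d) div 4"
  have q: "principal_form d X Y = X\<^sup>2 + X * Y + g * Y\<^sup>2" for X Y
    using d2 by (simp add: principal_form_def g_def)
  have A8: "\<exists>x y. (X\<^sup>2 + X * Y + g * Y\<^sup>2) mod 8 = (x\<^sup>2 - D * y\<^sup>2) mod 8" for X Y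
    using s odd_square_mult_mod_8[OF s(1)] q by metis
  have A4: "\<exists>x y. (X\<^sup>2 + X * Y + g * Y\<^sup>2) mod 4 = (x\<^sup>2 - D * y\<^sup>2) mod 4" for X Y
    using s odd_square_mult_mod_4[OF s(1)] q by metis
  have oD: "odd D"
  proof
    assume "even D"
    then have D8: "D mod 8 \<in> {0, 2, 4, 6}" using mod_8_cases[of D] by (auto; presburger)
    \<comment> \<open>The values at (1, 2) and (-1, 2) are 3 and 7 modulo 8, in an order depending
      on the parity of \<open>g\<close>.\<close>
    obtain x y where 1: "(1\<^sup>2 + 1 * 2 + g * 2\<^sup>2) mod 8 = (x\<^sup>2 - D * y\<^sup>2) mod 8" using A8 by blast
    obtain x' y' where 2: "((-1)\<^sup>2 + (-1) * 2 + g * 2\<^sup>2) mod 8 = (x'\<^sup>2 - D * y'\<^sup>2) mod 8" using A8 by blast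
    define h where "h = g mod 2"
    have h: "h = 0 \<or> h = 1" unfolding h_def by presburger
    have g2: "g = 2 * (g div 2) + h" unfolding h_def by simp
    have "1\<^sup>2 + 1 * 2 + g * 2\<^sup>2 = 3 + 4 * h + 8 * (g div 2)" by (subst g2) simp
    with 1 have 1: "(3 + 4 * h) mod 8 = (x\<^sup>2 - D * y\<^sup>2) mod 8" by (metis mod_mult_self2)
    have "(-1)\<^sup>2 + (-1) * 2 + g * 2\<^sup>2 = 7 + 4 * h + 8 * (g div 2 - 1)" by (subst g2) simp
    with 2 have 2: "(7 + 4 * h) mod 8 = (x'\<^sup>2 - D * y'\<^sup>2) mod 8" by (metis mod_mult_self2)
    \<comment> \<open>For even \<open>D\<close>, the odd values are 1 (\<open>y\<close> even) or
      \<open>1 - D\<close> (\<open>y\<close> odd) modulo 8, so 3 and 7 cannot both occur.\<close>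
    have *: "(x\<^sup>2 - D * y\<^sup>2) mod 8 \<in> {1, (1 - D mod 8) mod 8, 0, 2, 4, 6}" for x y
      unfolding square_form_mod[of x D y 8] using D8 mod_8_cases[of x] mod_8_cases[of y]
      by (elim insertE emptyE; simp only:; simp)
    show False using *[of x y] *[of x' y'] h unfolding 1[symmetric] 2[symmetric] by auto
  qed
  moreover have "d mod 8 \<noteq> 1"
  proof
    assume "d mod 8 = 1"
    then have "even g" unfolding g_def by presburger
    then have g: "g mod 4 = 0 \<or> g mod 4 = 2" by presburger
    \<comment> \<open>Chosen so that the value at \<open>(X, 1)\<close> is 2 modulo 4; the value at
      (1, 2) is 3 modulo 4.\<close>
    define X where "X = (if g mod 4 = 0 then 1 else 0 :: int)"
    obtain x y where 1: "(X\<^sup>2 + X * 1 + g * 1\<^sup>2) mod 4 = (x\<^sup>2 - D * y\<^sup>2) mod 4" using A4 by blast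
    obtain x' y' where 2: "(1\<^sup>2 + 1 * 2 + g * 2\<^sup>2) mod 4 = (x'\<^sup>2 - D * y'\<^sup>2) mod 4" using A4 by blast
    have 1: "(x\<^sup>2 - D * y\<^sup>2) mod 4 = 2" unfolding 1[symmetric] X_def using g by (simp; presburger)
    have 2: "(x'\<^sup>2 - D * y'\<^sup>2) mod 4 = 3" unfolding 2[symmetric] by (simp; presburger)
    have "D mod 4 = 1 \<or> D mod 4 = 3" using oD by presburger
    then show False using 1 2 square_form_mod_4_neq_2 square_form_mod_4_neq_3 by blast
  qed
  moreover have "d mod 8 = 1 \<or> d mod 8 = 5" using assms(1) by presburger
  ultimately show ?thesis by blast
qed

section \<open>Comparison of the two discriminants, prime by prime\<close>

text \<open>Since \<open>p\<close> is odd, the factor 2 from completing the square can be absorbed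
  into the multiplier.\<close>

lemma principal_transfer_odd_prime:
  assumes "principal_transfer p d D" "prime p" "p \<noteq> 2" "d \<noteq> 0"
    and d: "d mod 4 = 0 \<or> d mod 4 = 1" and D: "D mod 4 = 0 \<or> D mod 4 = 1"
  shows "multiplicity p D \<le> multiplicity p d"
proof -
  obtain s where s: "\<not> p dvd s" "\<forall>X Y. \<exists>x y. s\<^sup>2 * principal_form d X Y = principal_form D x y"
    using assms(1) unfolding principal_transfer_def by blast
  have "\<not> p dvd 2" using assms(2,3) by (metis primes_dvd_imp_eq two_is_prime_nat prime_int_numeral_eq)
  then have nd: "\<not> p dvd 2 * s" using s(1) assms(2) by (simp add: prime_dvd_mult_iff)
  have "\<exists>x y. (2 * s)\<^sup>2 * (X\<^sup>2 - d * Y\<^sup>2) = x\<^sup>2 - D * y\<^sup>2" for X Y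
  proof -
    obtain x y where "s\<^sup>2 * (X\<^sup>2 - d * Y\<^sup>2) = principal_form D x y"
      using s(2) principal_form_diff_squares[OF d, of X Y] by metis
    then have "(2 * s)\<^sup>2 * (X\<^sup>2 - d * Y\<^sup>2) = (2 * x + (D mod 2) * y)\<^sup>2 - D * y\<^sup>2"
      unfolding four_principal_form[OF D, symmetric] by (simp add: power_mult_distrib)
    then show ?thesis by blast
  qed
  with square_form_transfer_odd_multiplicity[OF assms(2,3) nd assms(4)] show ?thesis by blast
qed

text \<open>Here \<open>D\<close> is divisible by 4. If \<open>d\<close> were too, dividing both by
  4 would give diagonal forms, whose multiplicities cannot differ in this direction. So
  \<open>d\<close> is odd, and the residue argument shows that \<open>D / 4\<close> is odd.\<close>

lemma principal_transfer_two:
  assumes t: "principal_transfer 2 d D" "principal_transfer 2 D d" and nz: "d \<noteq> 0" "D \<noteq> 0"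
    and d: "d mod 4 = 0 \<or> d mod 4 = 1" and D: "D mod 4 = 0 \<or> D mod 4 = 1"
    and lt: "multiplicity 2 d < multiplicity 2 D"
  shows "d mod 8 = 5 \<and> multiplicity 2 D = multiplicity 2 (4 * d)"
proof -
  have "even D" using lt not_dvd_imp_multiplicity_0[of 2 D] by (cases "even D") simp_all
  then have "4 dvd D" using D by presburger
  then obtain D' where D': "D = 4 * D'" by blast
  have four: "multiplicity 2 (4 * z) = multiplicity 2 z + 2" if "z \<noteq> 0" for z :: int
  proof -
    have "multiplicity (2::int) (2 ^ 2 * z) = multiplicity (2::int) (2 ^ 2) + multiplicity 2 z"
      by (rule prime_elem_multiplicity_mult_distrib) (use that in simp_all)
    moreover have "multiplicity (2::int) (2 ^ 2) = 2" by (rule multiplicity_prime_power) simp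
    ultimately show ?thesis by simp
  qed
  have "odd d"
  proof
    assume "even d"
    then have "4 dvd d" using d by presburger
    then obtain d' where d': "d = 4 * d'" by blast
    obtain s where s: "odd s" "\<forall>X Y. \<exists>x y. s\<^sup>2 * (X\<^sup>2 - d' * Y\<^sup>2) = x\<^sup>2 - D' * y\<^sup>2"
      using t(1) unfolding principal_transfer_def d' D' principal_form_mult_four by blast
    obtain s' where s': "odd s'" "\<forall>X Y. \<exists>x y. s'\<^sup>2 * (X\<^sup>2 - D' * Y\<^sup>2) = x\<^sup>2 - d' * y\<^sup>2"
      using t(2) unfolding principal_transfer_def d' D' principal_form_mult_four by blast
    have "multiplicity 2 D' \<le> multiplicity 2 d'"
      using square_form_transfer_multiplicity_two[OF s(1) s'(1) _ s(2) s'(2)] nz d' by simp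
    then show False using lt nz unfolding d' D' by (simp add: four)
  qed
  then have "d mod 4 = 1" using d by presburger
  then have "odd D'" "d mod 8 = 5" using principal_transfer_odd_disc t(1) D' by blast+
  then show ?thesis using nz \<open>odd d\<close> by (simp add: D' four not_dvd_imp_multiplicity_0)
qed

lemma abs_eq_of_multiplicities:
  fixes a b :: int
  assumes "a \<noteq> 0" "b \<noteq> 0" "\<And>p. prime p \<Longrightarrow> multiplicity p a = multiplicity p b"
  shows "\<bar>a\<bar> = \<bar>b\<bar>"
  using multiplicity_eq_imp_eq[OF assms(1,2)] assms(3) by simp

lemma disc_eq_four_times:
  assumes t: "\<And>p. prime p \<Longrightarrow> principal_transfer p d D" "\<And>p. prime p \<Longrightarrow> principal_transfer p D d"
    and nz: "d \<noteq> 0" "D \<noteq> 0"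
    and d: "d mod 4 = 0 \<or> d mod 4 = 1" and D: "D mod 4 = 0 \<or> D mod 4 = 1"
    and lt: "multiplicity 2 d < multiplicity 2 D"
  shows "\<bar>D\<bar> = \<bar>4 * d\<bar> \<and> d mod 8 = 5"
proof -
  have 2: "d mod 8 = 5 \<and> multiplicity 2 D = multiplicity 2 (4 * d)"
    using principal_transfer_two[OF t(1) t(2) nz d D lt] by simp
  have "multiplicity p D = multiplicity p (4 * d)" if p: "prime p" for p
  proof (cases "p = 2")
    case False
    have "\<not> p dvd 2" using p False by (metis primes_dvd_imp_eq two_is_prime_nat prime_int_numeral_eq)
    then have "\<not> p dvd 2 ^ 2" using p prime_dvd_power by blast
    then have "multiplicity p 4 = 0" by (simp add: not_dvd_imp_multiplicity_0)
    then have "multiplicity p (4 * d) = multiplicity p d"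
      using prime_elem_multiplicity_mult_distrib[of p 4 d, OF prime_imp_prime_elem[OF p]] nz by simp
    moreover have "multiplicity p D = multiplicity p d"
      using principal_transfer_odd_prime t p False nz d D by (meson antisym)
    ultimately show ?thesis by simp
  qed (use 2 in simp)
  then have "\<bar>D\<bar> = \<bar>4 * d\<bar>" using nz by (intro abs_eq_of_multiplicities) auto
  with 2 show ?thesis by blast
qed

theorem theorem3p10:
  fixes f F :: bqf and d D :: int
  assumes "bqf_primitive f" and "bqf_primitive F"
    and "d = bqf_disc f" and "D = bqf_disc F"
    and "\<not> is_square d" and "\<not> is_square D"
    and "range (bqf_eval f) = range (bqf_eval F)"
  shows "sgn d = sgn D \<and> (d = D \<or> d = 4 * D \<or> 4 * d = D) \<and>
    (0 < \<bar>d\<bar> \<and> \<bar>d\<bar> < \<bar>D\<bar> \<longrightarrow> [d = 5] (mod 8))"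
proof -
  have t: "principal_transfer p d D" "principal_transfer p D d" if "prime p" for p
    using principal_transfer_of_range_eq[OF _ that] assms by metis+
  have d4: "d mod 4 = 0 \<or> d mod 4 = 1" and D4: "D mod 4 = 0 \<or> D mod 4 = 1"
    using bqf_disc_mod_4 assms by blast+
  have nz: "d \<noteq> 0" "D \<noteq> 0" using assms(5,6) by auto
  \<comment> \<open>Any prime serves here, since signs only require a nonzero multiplier; 2 is
    taken.\<close>
  have "d < 0 \<longleftrightarrow> D < 0"
    using principal_transfer_neg[OF t(1)[of 2] d4 D4] principal_transfer_neg[OF t(2)[of 2] D4 d4] nz
    by auto
  then have sgn: "sgn d = sgn D" using nz by (auto simp: sgn_if)
  have abs: "x = y" if "\<bar>x\<bar> = \<bar>y\<bar>" "sgn x = sgn y" for x y :: int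
    using that by (metis abs_mult_sgn mult.commute)
  consider "multiplicity 2 d < multiplicity 2 D" | "multiplicity 2 D < multiplicity 2 d"
    | "multiplicity 2 d = multiplicity 2 D" by linarith
  then show ?thesis
  proof cases
    case 1
    from disc_eq_four_times[OF t nz d4 D4 1] have *: "\<bar>D\<bar> = \<bar>4 * d\<bar>" "d mod 8 = 5" by auto
    have "D = 4 * d" by (rule abs) (use * sgn in \<open>auto simp: sgn_mult\<close>)
    then show ?thesis using * sgn by (simp add: cong_def)
  next
    case 2
    from disc_eq_four_times[OF t(2,1) nz(2,1) D4 d4 2] have *: "\<bar>d\<bar> = \<bar>4 * D\<bar>" by auto
    have "d = 4 * D" by (rule abs) (use * sgn in \<open>auto simp: sgn_mult\<close>)
    \<comment> \<open>Now \<open>d\<close> has the larger absolute value, so the congruence claim is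
      vacuous.\<close>
    then show ?thesis using * sgn by auto
  next
    case 3
    have "multiplicity p d = multiplicity p D" if p: "prime p" for p
      using principal_transfer_odd_prime[OF _ p] t[OF p] nz d4 D4 3 by (cases "p = 2") (auto intro: antisym)
    then have "\<bar>d\<bar> = \<bar>D\<bar>" using nz by (intro abs_eq_of_multiplicities)
    then have "d = D" using sgn by (rule abs)
    then show ?thesis by simp
  qed
qed

end
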